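(* Let $\alpha_1, A_1, \alpha_2, A_2 > 0$ and consider the system of difference equations $$x_{n+1}=\frac{\alpha_{1}}{A_{1}+y_{n}},\qquad y_{n+1}=\frac{\alpha_{2}}{A_{2}},\qquad n=0,1,2,\dots,$$ with arbitrary nonnegative initial conditions $x_0,y_0$. This system has a unique equilibrium $$(\bar{x},\bar{y})=\left(\frac{A_{2}\alpha_{1}}{A_{2}A_{1}+\alpha_{2}},\frac{\alpha_{2}}{A_{2}}\right).$$ Moreover, every solution is equal to the equilibrium after at most two steps, i.e. $(x_n,y_n)=(\bar x,\bar y)$ for all $n\ge 2$.
   Context: The state space consists of nonnegative points. An equilibrium is a point $(\bar x,\bar y)\in[0,\infty)^2$ such that the constant sequence $(x_n,y_n)=(\bar x,\bar y)$ solves the system. *)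

theory Defs
  imports Complex_Main
begin

text \<open>
  Only the initial conditions are required to be nonnegative; for positive parameters the
  recursion then keeps all later terms nonnegative, so no denominator below vanishes.
\<close>

definition is_solution ::
  "real \<Rightarrow> real \<Rightarrow> real \<Rightarrow> real \<Rightarrow> (nat \<Rightarrow> real \<times> real) \<Rightarrow> bool" where
  "is_solution \<alpha>1 A1 \<alpha>2 A2 z \<longleftrightarrow>
     0 \<le> fst (z 0) \<and> 0 \<le> snd (z 0) \<and>
     (\<forall>n. fst (z (Suc n)) = \<alpha>1 / (A1 + snd (z n)) \<and> snd (z (Suc n)) = \<alpha>2 / A2)"

definition is_equilibrium ::
  "real \<Rightarrow> real \<Rightarrow> real \<Rightarrow> real \<Rightarrow> real \<times> real \<Rightarrow> bool" where
  "is_equilibrium \<alpha>1 A1 \<alpha>2 A2 p \<longleftrightarrow>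
     p \<in> {0..} \<times> {0..} \<and> is_solution \<alpha>1 A1 \<alpha>2 A2 (\<lambda>n. p)"

end

theory Submission
  imports Defs
begin

text \<open>The second coordinate forgets its past at once: it is \<alpha>2 / A2 from index 1 on.
  The first coordinate depends only on the preceding second one, so from index 2 on it is frozen at
  \<alpha>1 / (A1 + \<alpha>2 / A2), which is the claimed value by \<open>fixed\<close>. Uniqueness
  follows from this collapse, since an equilibrium is itself a solution.\<close>

theorem theorem1:
  fixes \<alpha>1 A1 \<alpha>2 A2 :: real
  assumes "\<alpha>1 > 0" and "A1 > 0" and "\<alpha>2 > 0" and "A2 > 0"
  shows "(\<exists>!p. is_equilibrium \<alpha>1 A1 \<alpha>2 A2 p)
    \<and> is_equilibrium \<alpha>1 A1 \<alpha>2 A2 (A2 * \<alpha>1 / (A2 * A1 + \<alpha>2), \<alpha>2 / A2)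
    \<and> (\<forall>z. is_solution \<alpha>1 A1 \<alpha>2 A2 z \<longrightarrow>
          (\<forall>n\<ge>2. z n = (A2 * \<alpha>1 / (A2 * A1 + \<alpha>2), \<alpha>2 / A2)))"
proof -
  let ?q = "(A2 * \<alpha>1 / (A2 * A1 + \<alpha>2), \<alpha>2 / A2)"
  have pos: "A2 * A1 + \<alpha>2 > 0"
    using assms by (simp add: add_pos_pos)
  have fixed: "\<alpha>1 / (A1 + \<alpha>2 / A2) = A2 * \<alpha>1 / (A2 * A1 + \<alpha>2)"
  proof -
    have "A1 + \<alpha>2 / A2 = (A2 * A1 + \<alpha>2) / A2"
      using assms(4) by (simp add: field_simps)
    then show ?thesis
      by (simp add: mult.commute)
  qed
  have eq: "is_equilibrium \<alpha>1 A1 \<alpha>2 A2 ?q"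
    using assms pos fixed by (simp add: is_equilibrium_def is_solution_def)
  have sol: "z n = ?q" if z: "is_solution \<alpha>1 A1 \<alpha>2 A2 z" and n: "n \<ge> 2" for z n
  proof -
    obtain m where m: "n = Suc (Suc m)"
      using n by (metis One_nat_def Suc_1 Suc_le_D Suc_le_mono)
    \<comment> \<open>Index \<open>Suc m\<close> already has second coordinate \<alpha>2 / A2; at
      \<open>Suc m\<close> itself the first coordinate may still depend on the arbitrary
      \<open>snd (z 0)\<close>, when \<open>m = 0\<close>.\<close>
    show ?thesis
      using z fixed unfolding is_solution_def m by (simp add: prod_eq_iff)
  qed
  \<comment> \<open>The constant sequence at \<open>p\<close> is a solution, so its term at index 2,
    which is \<open>p\<close>, must be \<open>?q\<close>.\<close>
  have "p = ?q" if "is_equilibrium \<alpha>1 A1 \<alpha>2 A2 p" for p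
    using sol[of "\<lambda>_. p" 2] that unfolding is_equilibrium_def by simp
  with eq sol show ?thesis
    by blast
qed

end
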